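(* Let $\Sigma=(\mathcal X,\mathcal U,\phi)$ be a forward complete system with inputs, endowed with an admissible functional $\|\cdot\|_{\mathcal U}$ such that for every $u\in\mathcal U$ and all $0\le t_1<t_2<t_3$ one has $\|u_{(t_1,t_3]}\|_{\mathcal U}\ge \|u_{(t_1,t_2]}\|_{\mathcal U}+\|u_{(t_2,t_3]}\|_{\mathcal U}$. Suppose that the following continuity assumption holds: for every $r>0$, $\varepsilon>0$ and $T>0$ there exists $\delta=\delta(r,\varepsilon,T)>0$ such that for every $t_0\ge 0$, $x_0\in\mathcal X$ and $u\in\mathcal U$ with $\|u\|_{\mathcal U}\le\delta$, if for some $t^*\in[t_0,t_0+T]$ one has $\|x(t)\|_{\mathcal X}\le r$ and $\|z(t)\|_{\mathcal X}\le r$ for all $t\in[t_0,t^*]$, where $x(t)=\phi(t,t_0,x_0,u)$ and $z(t)=\phi(t,t_0,x_0,\mathbf 0)$, then $\|z(t)-x(t)\|_{\mathcal X}\le\varepsilon$ for all $t\in[t_0,t^*]$. Then the following are equivalent: (a) $\Sigma$ is 0-GUAS and UBEBS; (b) $\Sigma$ is iISS (UBEBS and iISS being understood with respect to $\|\cdot\|_{\mathcal U}$).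
   Context: Comparison functions. $\alpha\in\mathcal K$ if $\alpha:\mathbb R_{\ge0}\to\mathbb R_{\ge0}$ is continuous, strictly increasing, $\alpha(0)=0$; $\alpha\in\mathcal K_\infty$ if moreover unbounded. $\beta\in\mathcal{KL}$ if $\beta:\mathbb R_{\ge0}\times\mathbb R_{\ge0}\to\mathbb R_{\ge0}$, $\beta(\cdot,t)\in\mathcal K$ for each $t\ge0$, and for each fixed $r\ge0$, $\beta(r,t)$ decreases monotonically to $0$ as $t\to\infty$. Convention: $\rho(\infty)=\infty$ for $\rho\in\mathcal K_\infty$. System with inputs. $\Sigma=(\mathcal X,\mathcal U,\phi)$ where: (1) $(\mathcal X,\|\cdot\|_{\mathcal X})$ is a normed vector space. (2) $\mathcal U$ is a set of functions $u:\mathbb R_{\ge0}\to\mathsf U$, with $\mathsf U$ a vector space, containing the zero input $\mathbf 0$ (identically $0$) and closed under concatenation: if $u,v\in\mathcal U$ and $t\ge0$, then the function equal to $u(\tau)$ for $\tau\le t$ and to $v(\tau)$ for $\tau>t$ is in $\mathcal U$. (3) $\phi:D_\phi\to\mathcal X$ with $D_\phi\subset\{(t,s,x,u):t\ge s\ge0,\ x\in\mathcal X,\ u\in\mathcal U\}$, and for all $s\ge 0$, $x\in\mathcal X$, $u\in\mathcal U$, $\{t:(t,s,x,u)\in D_\phi\}=[s,t_{(s,x,u)})$ with $s<t_{(s,x,u)}\le\infty$. The following must hold. Identity: $\phi(t,t,x,u)=x$. Causality: if $(t,s,x,u)\in D_\phi$, $t>s$, and $v\in\mathcal U$ satisfies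 $v=u$ on $(s,t]$, then $(t,s,x,v)\in D_\phi$ and $\phi(t,s,x,v)=\phi(t,s,x,u)$. Semigroup: if $(t,s,x,u)\in D_\phi$ and $s<\tau<t$, then $\phi(t,\tau,\phi(\tau,s,x,u),u)=\phi(t,s,x,u)$. No continuity of $t\mapsto \phi(t,s,x,u)$ is assumed. $\Sigma$ is forward complete if $t_{(s,x,u)}=\infty$ for all $s,x,u$. For an interval $J\subset\mathbb R_{\ge0}$, $u_J(\tau)=u(\tau)$ if $\tau\in J$ and $u_J(\tau)=0$ otherwise. Admissible functional. $\|\cdot\|_{\mathcal U}:\mathcal U\to\mathbb R_{\ge0}\cup\{\infty\}$ (not necessarily a norm) with $\|\mathbf 0\|_{\mathcal U}=0$ and, for all $0\le s<t<\infty$ and $u\in\mathcal U$, $\|u_{(s,t]}\|_{\mathcal U}<\infty$ and $\|u_{(s,t]}\|_{\mathcal U}\le\|u_{(s,\infty)}\|_{\mathcal U}\le\|u\|_{\mathcal U}$. Stability notions. 0-GUAS: there is $\beta\in\mathcal{KL}$ such that for all $t_0\ge0$, $x_0\in\mathcal X$, $\phi(t,t_0,x_0,\mathbf 0)$ is defined for all $t\ge t_0$ and $\|\phi(t,t_0,x_0,\mathbf 0)\|_{\mathcal X}\le\beta(\|x_0\|_{\mathcal X},t-t_0)$. UBEBS: $\Sigma$ is forward complete and there are $\alpha,\rho\in\mathcal K_\infty$, $c\ge0$ such that $\|\phi(t,t_0,x_0,u)\|_{\mathcal X}\le c+\alpha(\|x_0\|_{\mathcal X})+\rho(\|u\|_{\mathcal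 U})$ for all $t\ge t_0\ge0$, $x_0\in\mathcal X$, $u\in\mathcal U$. iISS: $\Sigma$ is forward complete and there are $\beta\in\mathcal{KL}$, $\rho\in\mathcal K_\infty$ such that $\|\phi(t,t_0,x_0,u)\|_{\mathcal X}\le\beta(\|x_0\|_{\mathcal X},t-t_0)+\rho(\|u\|_{\mathcal U})$ for all $t\ge t_0\ge0$, $x_0\in\mathcal X$, $u\in\mathcal U$. *)

theory Defs
  imports Complex_Main "HOL-Library.Extended_Nonnegative_Real"
begin

text \<open>
  Functions on the nonnegative reals are represented by functions on \<open>real\<close> of which only the
  values on \<open>{0..}\<close> matter. For the comparison functions the codomain condition is explicit.
\<close>

definition class_K :: "(real \<Rightarrow> real) \<Rightarrow> bool" where
  "class_K \<alpha> \<longleftrightarrow> \<alpha> \<in> {0..} \<rightarrow> {0..} \<and> continuous_on {0..} \<alpha> \<and> strict_mono_on {0..} \<alpha> \<and> \<alpha> 0 = 0"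

definition class_Kinf :: "(real \<Rightarrow> real) \<Rightarrow> bool" where
  "class_Kinf \<alpha> \<longleftrightarrow> class_K \<alpha> \<and> \<not> bdd_above (\<alpha> ` {0..})"

text \<open>The decrease in the second argument is not strict: \<open>\<beta> 0 t = 0\<close> for all \<open>t \<ge> 0\<close>.\<close>

definition class_KL :: "(real \<Rightarrow> real \<Rightarrow> real) \<Rightarrow> bool" where
  "class_KL \<beta> \<longleftrightarrow>
     (\<forall>t\<ge>0. class_K (\<lambda>r. \<beta> r t)) \<and>
     (\<forall>r\<ge>0. antimono_on {0..} (\<beta> r) \<and> (\<beta> r \<longlongrightarrow> 0) at_top)"

text \<open>Extension of a gain to \<open>[0, \<infinity>]\<close> by the convention \<open>\<rho>(\<infinity>) = \<infinity>\<close>.\<close>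

definition gain_ext :: "(real \<Rightarrow> real) \<Rightarrow> ennreal \<Rightarrow> ennreal" where
  "gain_ext \<rho> a = (if a = \<infinity> then \<infinity> else ennreal (\<rho> (enn2real a)))"

text \<open>
  An input is represented by its extension by zero to the negative reals, so that equality of
  inputs is equality of functions. The transition map \<open>flow\<close> is partial: its value at
  \<open>(t, s, x, u)\<close> is meaningful only if \<open>(t, s, x, u) \<in> flow_dom\<close>.
\<close>

record ('x, 'v) input_system =
  inputs :: "(real \<Rightarrow> 'v) set"
  flow_dom :: "(real \<times> real \<times> 'x \<times> (real \<Rightarrow> 'v)) set"
  flow :: "real \<Rightarrow> real \<Rightarrow> 'x \<Rightarrow> (real \<Rightarrow> 'v) \<Rightarrow> 'x"

definition zero_input :: "real \<Rightarrow> 'v::zero" where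
  "zero_input = (\<lambda>_. 0)"

definition concat_input :: "real \<Rightarrow> (real \<Rightarrow> 'v) \<Rightarrow> (real \<Rightarrow> 'v) \<Rightarrow> real \<Rightarrow> 'v" where
  "concat_input t u v = (\<lambda>\<tau>. if \<tau> \<le> t then u \<tau> else v \<tau>)"

definition restrict_input :: "real set \<Rightarrow> (real \<Rightarrow> 'v::zero) \<Rightarrow> real \<Rightarrow> 'v" where
  "restrict_input J u = (\<lambda>\<tau>. if \<tau> \<in> J then u \<tau> else 0)"

definition max_time ::
    "('x, 'v) input_system \<Rightarrow> real \<Rightarrow> 'x \<Rightarrow> (real \<Rightarrow> 'v) \<Rightarrow> ereal" where
  "max_time \<Sigma> s x u = (SUP t\<in>{t. (t, s, x, u) \<in> flow_dom \<Sigma>}. ereal t)"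

text \<open>
  In the semigroup property, the equation between values of the partial map \<open>flow\<close> includes that
  its left-hand side is defined.
\<close>

definition system_with_inputs ::
    "('x::real_normed_vector, 'v::real_vector) input_system \<Rightarrow> bool" where
  "system_with_inputs \<Sigma> \<longleftrightarrow>
     (\<forall>u\<in>inputs \<Sigma>. \<forall>\<tau><0. u \<tau> = 0) \<and>
     zero_input \<in> inputs \<Sigma> \<and>
     (\<forall>u\<in>inputs \<Sigma>. \<forall>v\<in>inputs \<Sigma>. \<forall>t\<ge>0. concat_input t u v \<in> inputs \<Sigma>) \<and>
     flow_dom \<Sigma> \<subseteq> {(t, s, x, u). 0 \<le> s \<and> s \<le> t \<and> u \<in> inputs \<Sigma>} \<and>
     (\<forall>s\<ge>0. \<forall>x. \<forall>u\<in>inputs \<Sigma>.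
        ereal s < max_time \<Sigma> s x u \<and>
        {t. (t, s, x, u) \<in> flow_dom \<Sigma>} = {t. s \<le> t \<and> ereal t < max_time \<Sigma> s x u}) \<and>
     (\<forall>t\<ge>0. \<forall>x. \<forall>u\<in>inputs \<Sigma>. flow \<Sigma> t t x u = x) \<and>
     (\<forall>t s x u v. (t, s, x, u) \<in> flow_dom \<Sigma> \<and> s < t \<and> v \<in> inputs \<Sigma> \<and> (\<forall>\<tau>\<in>{s<..t}. v \<tau> = u \<tau>) \<longrightarrow>
        (t, s, x, v) \<in> flow_dom \<Sigma> \<and> flow \<Sigma> t s x v = flow \<Sigma> t s x u) \<and>
     (\<forall>t s x u \<tau>. (t, s, x, u) \<in> flow_dom \<Sigma> \<and> s < \<tau> \<and> \<tau> < t \<longrightarrow>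
        (t, \<tau>, flow \<Sigma> \<tau> s x u, u) \<in> flow_dom \<Sigma> \<and>
        flow \<Sigma> t \<tau> (flow \<Sigma> \<tau> s x u) u = flow \<Sigma> t s x u)"

definition forward_complete :: "('x, 'v) input_system \<Rightarrow> bool" where
  "forward_complete \<Sigma> \<longleftrightarrow> (\<forall>s\<ge>0. \<forall>x. \<forall>u\<in>inputs \<Sigma>. max_time \<Sigma> s x u = \<infinity>)"

definition admissible_functional ::
    "('x, 'v::zero) input_system \<Rightarrow> ((real \<Rightarrow> 'v) \<Rightarrow> ennreal) \<Rightarrow> bool" where
  "admissible_functional \<Sigma> N \<longleftrightarrow>
     N zero_input = 0 \<and>
     (\<forall>s t. \<forall>u\<in>inputs \<Sigma>. 0 \<le> s \<and> s < t \<longrightarrow>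
        N (restrict_input {s<..t} u) < \<infinity> \<and>
        N (restrict_input {s<..t} u) \<le> N (restrict_input {s<..} u) \<and>
        N (restrict_input {s<..} u) \<le> N u)"

definition zero_GUAS :: "('x::real_normed_vector, 'v::zero) input_system \<Rightarrow> bool" where
  "zero_GUAS \<Sigma> \<longleftrightarrow>
     (\<exists>\<beta>. class_KL \<beta> \<and>
        (\<forall>t0\<ge>0. \<forall>x0. \<forall>t\<ge>t0.
           (t, t0, x0, zero_input) \<in> flow_dom \<Sigma> \<and>
           norm (flow \<Sigma> t t0 x0 zero_input) \<le> \<beta> (norm x0) (t - t0)))"

definition UBEBS ::
    "('x::real_normed_vector, 'v) input_system \<Rightarrow> ((real \<Rightarrow> 'v) \<Rightarrow> ennreal) \<Rightarrow> bool" where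
  "UBEBS \<Sigma> N \<longleftrightarrow>
     forward_complete \<Sigma> \<and>
     (\<exists>\<alpha> \<rho> c. class_Kinf \<alpha> \<and> class_Kinf \<rho> \<and> 0 \<le> c \<and>
        (\<forall>t0\<ge>0. \<forall>t\<ge>t0. \<forall>x0. \<forall>u\<in>inputs \<Sigma>.
           ennreal (norm (flow \<Sigma> t t0 x0 u)) \<le>
             ennreal c + ennreal (\<alpha> (norm x0)) + gain_ext \<rho> (N u)))"

definition iISS ::
    "('x::real_normed_vector, 'v) input_system \<Rightarrow> ((real \<Rightarrow> 'v) \<Rightarrow> ennreal) \<Rightarrow> bool" where
  "iISS \<Sigma> N \<longleftrightarrow>
     forward_complete \<Sigma> \<and>
     (\<exists>\<beta> \<rho>. class_KL \<beta> \<and> class_Kinf \<rho> \<and>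
        (\<forall>t0\<ge>0. \<forall>t\<ge>t0. \<forall>x0. \<forall>u\<in>inputs \<Sigma>.
           ennreal (norm (flow \<Sigma> t t0 x0 u)) \<le>
             ennreal (\<beta> (norm x0) (t - t0)) + gain_ext \<rho> (N u)))"

end

theory Submission
  imports Defs "HOL-Analysis.Equivalence_Measurable_On_Borel"
begin

text \<open>
  That iISS implies the other two properties is immediate: the zero input has functional value \<open>0\<close>,
  and \<open>\<beta> r t \<le> \<beta> r 0\<close>. The substance is the converse, whose two ingredients are a comparison with
  the zero-input trajectory on windows of fixed length and a pigeonhole argument in time.

  UBEBS confines all trajectories with bounded data to a ball, so the continuity assumption becomes
  unconditional there: on a window of length \<open>T\<close>, a trajectory whose input is small enough stays
  within \<open>\<epsilon>\<close> of the 0-GUAS bound (\<open>close_to_zero_input_flow\<close>). If \<open>T\<close> is so long that the zero-input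
  bound halves, the error is absorbed at the end of every window, and iterating over windows shows
  that small initial states and small inputs give small trajectories for all time
  (\<open>small_data_small_flow\<close>). This removes the constant \<open>c\<close> of UBEBS: for inputs of finite size,
  \<open>|x(t)| \<le> \<sigma>(|x0|) + \<sigma>(|u|)\<close> for one \<open>\<sigma>\<close> of class \<open>\<K>\<^sub>\<infinity>\<close> (\<open>Kinf_bound\<close>).

  A large input of finite size \<open>R\<close> need not be small on the first window. However, if it exceeded
  \<open>\<delta>\<close> on each of \<open>K > R / \<delta>\<close> consecutive windows, superadditivity would make its total exceed \<open>R\<close>.
  So one of the first \<open>K\<close> windows is quiet (\<open>quiet_interval\<close>); at its end the state is small, and
  restarting the \<open>\<sigma>\<close>-bound from there leaves only an arbitrarily small term besides the input gain,
  after a time \<open>K * T\<close> that depends only on the bounds of the data (\<open>uniform_attractivity\<close>).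

  Finally, the excess of \<open>|x|\<close> over the input gain is bounded by a function of \<open>|x0|\<close> and elapsed time
  that is monotone and vanishes as time grows, but need not be continuous; averaging it over a range of
  dilations turns it into a function of class \<open>\<K>\<L>\<close> (\<open>KL_majorant\<close>).
\<close>

section \<open>Continuous majorants of monotone functions\<close>

text \<open>
  For \<open>r > 0\<close> this is the mean \<open>(1 / r) * \<integral>\<close> of \<open>g\<close> over \<open>[r, 2 r]\<close>. In the form chosen here the range of
  integration is fixed, so monotonicity in \<open>r\<close> and \<open>g\<close> is inherited pointwise and \<open>r = 0\<close> needs no
  separate clause.
\<close>

definition dilation_average :: "(real \<Rightarrow> real) \<Rightarrow> real \<Rightarrow> real" where
  "dilation_average g r = integral {1..2} (\<lambda>v. g (r * v))"

lemma integrable_dilation: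
  fixes g :: "real \<Rightarrow> real"
  assumes "mono_on {0..} g" "0 \<le> r"
  shows "(\<lambda>v. g (r * v)) integrable_on {1..2}"
proof (rule integrable_on_mono_on)
  show "mono_on {1..2} (\<lambda>v. g (r * v))"
    using assms by (auto intro!: mono_onI mono_onD[OF assms(1)] mult_left_mono)
qed

lemma dilation_average_mono:
  assumes "mono_on {0..} g" "mono_on {0..} h" "0 \<le> r" "r \<le> r'"
    and le: "\<And>x. 0 \<le> x \<Longrightarrow> g x \<le> h x"
  shows "dilation_average g r \<le> dilation_average h r'"
  unfolding dilation_average_def
proof (rule integral_le)
  show "(\<lambda>v. g (r * v)) integrable_on {1..2}" "(\<lambda>v. h (r' * v)) integrable_on {1..2}"
    using assms by (auto intro!: integrable_dilation)
  fix v :: real assume v: "v \<in> {1..2}"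
  have "g (r * v) \<le> h (r * v)" using v assms by (auto intro!: le)
  also have "\<dots> \<le> h (r' * v)"
    using v assms by (auto intro!: mono_onD[OF assms(2)] mult_right_mono)
  finally show "g (r * v) \<le> h (r' * v)" .
qed

text \<open>
  The arguments \<open>r * v\<close> with \<open>1 \<le> v \<le> 2\<close> lie between \<open>r\<close> and \<open>2 * r\<close>: averaging to the right of \<open>r\<close>
  makes the mean a majorant of a monotone function.
\<close>

lemma dilation_average_bounds:
  assumes g: "mono_on {0..} g" and r: "0 \<le> r"
  shows "g r \<le> dilation_average g r" "dilation_average g r \<le> g (2 * r)"
proof -
  have "integral {1..2::real} (\<lambda>v. g r) \<le> dilation_average g r"
    unfolding dilation_average_def
    using r by (intro integral_le integrable_dilation[OF g])
      (auto intro!: mono_onD[OF g] simp: mult_le_cancel_left1)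
  then show "g r \<le> dilation_average g r" by simp
  have "dilation_average g r \<le> integral {1..2::real} (\<lambda>v. g (2 * r))"
    unfolding dilation_average_def
    using r by (intro integral_le integrable_dilation[OF g])
      (auto intro!: mono_onD[OF g] mult_left_mono simp: mult.commute[of 2])
  then show "dilation_average g r \<le> g (2 * r)" by simp
qed

lemma dilation_average_nonneg:
  assumes "mono_on {0..} g" "g 0 = 0" "0 \<le> r"
  shows "0 \<le> dilation_average g r"
  using dilation_average_bounds(1)[OF assms(1,3)] mono_onD[OF assms(1), of 0 r] assms by auto

text \<open>
  Away from \<open>0\<close> the average is a quotient built from an indefinite integral of \<open>g\<close>, hence continuous
  although \<open>g\<close> may jump; at \<open>0\<close> it is squeezed between \<open>0\<close> and \<open>g (2 * r)\<close>.
\<close>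

lemma dilation_average_continuous:
  assumes g: "mono_on {0..} g" and g0: "g 0 = 0" and lim: "(g \<longlongrightarrow> 0) (at_right 0)"
  shows "continuous_on {0..} (dilation_average g)"
proof -
  have pos: "isCont (dilation_average g) r" if r: "0 < r" for r
  proof -
    define F where "F x = integral {0..x} g" for x
    define b where "b = 4 * r"
    have int: "g integrable_on {a..c}" if "0 \<le> a" for a c
      by (rule integrable_on_mono_on, rule mono_on_subset[OF g]) (use that in auto)
    have F: "isCont F x" if "0 < x" "x < b" for x
    proof -
      have "continuous_on {0..b} F"
        unfolding F_def by (intro indefinite_integral_continuous_1 int) auto
      then show ?thesis
        using that by (intro continuous_on_interior[of "{0..b}"]) auto
    qed
    \<comment> \<open>Substitution \<open>y = x * v\<close> moves the dilation into the limits of integration.\<close>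
    have eq: "dilation_average g x = (F (2 * x) - F x) / x" if "0 < x" for x
    proof -
      have "((\<lambda>v. g (x * v)) has_integral (1 / \<bar>x\<bar>) *\<^sub>R integral {x..2*x} g) ((\<lambda>y. y / x) ` {x..2*x})"
        using that by (intro has_integral_stretch_real integrable_integral int) auto
      moreover have "(\<lambda>y. y / x) ` {x..2*x} = {1..2}"
        using that by (auto simp: image_iff field_simps intro!: bexI[of _ "x * _"])
      ultimately have "dilation_average g x = integral {x..2*x} g / x"
        using that unfolding dilation_average_def by (simp add: integral_unique)
      moreover have "integral {0..x} g + integral {x..2*x} g = integral {0..2*x} g"
        using that by (intro Henstock_Kurzweil_Integration.integral_combine int) auto
      ultimately show ?thesis by (simp add: F_def)
    qed
    have "isCont (\<lambda>x. (F (2 * x) - F x) / x) r"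
      using r by (intro continuous_intros isCont_o2[of _ "\<lambda>x. 2 * x" F] F) (auto simp: b_def)
    moreover have "\<forall>\<^sub>F x in nhds r. (F (2 * x) - F x) / x = dilation_average g x"
      using eventually_nhds_in_open[of "{0<..}" r] r
      by (auto elim!: eventually_mono simp: eq)
    ultimately show ?thesis
      using isCont_cong by fast
  qed
  have "(dilation_average g \<longlongrightarrow> 0) (at_right 0)"
  proof (rule tendsto_sandwich[OF _ _ tendsto_const])
    have "filterlim (\<lambda>r::real. 2 * r) (at_right 0) (at_right 0)"
      by (auto simp: filterlim_at eventually_at_filter intro!: tendsto_eq_intros)
    from filterlim_compose[OF lim this]
    show "((\<lambda>r. g (2 * r)) \<longlongrightarrow> 0) (at_right 0)" .
    show "\<forall>\<^sub>F r in at_right 0. 0 \<le> dilation_average g r"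
      using dilation_average_nonneg[OF g g0] by (auto simp: eventually_at_filter)
    show "\<forall>\<^sub>F r in at_right 0. dilation_average g r \<le> g (2 * r)"
      using dilation_average_bounds(2)[OF g] by (auto simp: eventually_at_filter)
  qed
  moreover have "dilation_average g 0 = 0"
    by (simp add: dilation_average_def g0)
  ultimately have "continuous (at 0 within {0..}) (dilation_average g)"
    by (simp add: continuous_within at_within_Ici_at_right)
  then have "continuous (at r within {0..}) (dilation_average g)" if "0 \<le> r" for r
    using pos[of r] that by (cases "r = 0") (auto intro: continuous_at_imp_continuous_within)
  then show ?thesis by (simp add: continuous_on_eq_continuous_within)
qed

lemma class_K_nonneg: "class_K \<alpha> \<Longrightarrow> 0 \<le> r \<Longrightarrow> 0 \<le> \<alpha> r"
  by (auto simp: class_K_def Pi_iff)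

lemma class_K_mono: "class_K \<alpha> \<Longrightarrow> 0 \<le> r \<Longrightarrow> r \<le> r' \<Longrightarrow> \<alpha> r \<le> \<alpha> r'"
  unfolding class_K_def using strict_mono_on_leD[of "{0..}" \<alpha> r r'] by auto

lemma class_K_tendsto: "class_K \<alpha> \<Longrightarrow> (\<alpha> \<longlongrightarrow> 0) (at_right 0)"
  unfolding class_K_def continuous_on_def
  by (metis at_within_Ici_at_right atLeast_iff order_refl)

lemma class_K_small:
  assumes "class_K \<alpha>" "0 < \<epsilon>"
  shows "\<exists>\<delta>>0. \<alpha> \<delta> \<le> \<epsilon>"
proof -
  have "\<forall>\<^sub>F x in at_right 0. \<alpha> x < \<epsilon>"
    using class_K_tendsto[OF assms(1)] assms(2) by (rule order_tendstoD)
  then obtain b where b: "b > 0" "\<And>y. 0 < y \<Longrightarrow> y < b \<Longrightarrow> \<alpha> y < \<epsilon>"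
    by (auto simp: eventually_at_right_field)
  then show ?thesis using dense[of 0 b] by (metis less_imp_le)
qed

text \<open>
  The linear term makes the monotone average strictly increasing.
\<close>

lemma class_K_average:
  assumes g: "mono_on {0..} g" and g0: "g 0 = 0" and lim: "(g \<longlongrightarrow> 0) (at_right 0)" and c: "0 < c"
  shows "class_K (\<lambda>r. dilation_average g r + c * r)"
proof -
  have "dilation_average g x + c * x < dilation_average g y + c * y" if "0 \<le> x" "x < y" for x y
    using dilation_average_mono[OF g g that(1) less_imp_le[OF that(2)]] that c
    by (intro add_le_less_mono) auto
  moreover have "0 \<le> dilation_average g r" if "0 \<le> r" for r
    using g g0 that by (rule dilation_average_nonneg)
  moreover have "dilation_average g 0 = 0"
    by (simp add: dilation_average_def g0)
  ultimately show ?thesis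
    unfolding class_K_def
    using dilation_average_continuous[OF g g0 lim] c
    by (auto intro!: continuous_intros strict_mono_onI)
qed

lemma class_Kinf_if_ge_linear:
  assumes "class_K \<alpha>" "0 < c" "\<And>r. 0 \<le> r \<Longrightarrow> c * r \<le> \<alpha> r"
  shows "class_Kinf \<alpha>"
proof -
  have False if "\<forall>x\<in>\<alpha> ` {0..}. x \<le> M" for M
  proof -
    have "c * ((\<bar>M\<bar> + 1) / c) \<le> \<alpha> ((\<bar>M\<bar> + 1) / c)"
      using assms by (intro assms) auto
    also have "\<dots> \<le> M" using assms(2) that by auto
    finally show False using assms(2) by simp
  qed
  then show ?thesis using assms(1) by (auto simp: class_Kinf_def bdd_above_def)
qed

lemma Kinf_majorant:
  assumes g: "mono_on {0..} g" and g0: "g 0 = 0" and lim: "(g \<longlongrightarrow> 0) (at_right 0)"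
  shows "\<exists>\<sigma>. class_Kinf \<sigma> \<and> (\<forall>r\<ge>0. g r \<le> \<sigma> r)"
proof (intro exI conjI allI impI)
  let ?\<sigma> = "\<lambda>r. dilation_average g r + 1 * r"
  have ge: "g r \<le> dilation_average g r" "0 \<le> g r" if "0 \<le> r" for r
    using dilation_average_bounds(1)[OF g that] mono_onD[OF g, of 0 r] g0 that by auto
  show "class_Kinf ?\<sigma>"
    by (rule class_Kinf_if_ge_linear[OF class_K_average[OF assms], of 1 1])
      (use ge in force)+
  show "g r \<le> ?\<sigma> r" if "0 \<le> r" for r
    using ge[OF that] that by simp
qed

text \<open>
  Averaging in \<open>r\<close> for each fixed \<open>t\<close> keeps the monotonicity and, through the upper bound by
  \<open>\<psi> (2 * r) t\<close>, the decay in \<open>t\<close>. The majorant \<open>\<sigma>\<close>, the same for all \<open>t\<close>, forces \<open>\<psi>\<close> to vanish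
  continuously at \<open>r = 0\<close>. The linear term that provides strictness in \<open>r\<close> is damped by \<open>exp (- t)\<close>
  so that it decays too.
\<close>

lemma KL_majorant:
  assumes mono: "\<And>t. 0 \<le> t \<Longrightarrow> mono_on {0..} (\<lambda>r. \<psi> r t)"
    and anti: "\<And>r. 0 \<le> r \<Longrightarrow> antimono_on {0..} (\<psi> r)"
    and lim: "\<And>r. 0 \<le> r \<Longrightarrow> (\<psi> r \<longlongrightarrow> 0) at_top"
    and nonneg: "\<And>r t. 0 \<le> r \<Longrightarrow> 0 \<le> t \<Longrightarrow> 0 \<le> \<psi> r t"
    and le: "\<And>r t. 0 \<le> r \<Longrightarrow> 0 \<le> t \<Longrightarrow> \<psi> r t \<le> \<sigma> r"
    and \<sigma>: "class_K \<sigma>"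
  shows "\<exists>\<beta>. class_KL \<beta> \<and> (\<forall>r\<ge>0. \<forall>t\<ge>0. \<psi> r t \<le> \<beta> r t)"
proof (intro exI conjI allI impI)
  let ?\<beta> = "\<lambda>r t. dilation_average (\<lambda>r. \<psi> r t) r + exp (- t) * r"
  have K: "class_K (\<lambda>r. ?\<beta> r t)" if t: "0 \<le> t" for t
  proof (rule class_K_average)
    show "\<psi> 0 t = 0"
      using nonneg[of 0 t] le[of 0 t] \<sigma> t by (simp add: class_K_def)
    show "((\<lambda>r. \<psi> r t) \<longlongrightarrow> 0) (at_right 0)"
      using nonneg le t
      by (intro tendsto_sandwich[OF _ _ tendsto_const class_K_tendsto[OF \<sigma>]])
        (auto simp: eventually_at_filter)
  qed (use mono t in auto)
  have A: "antimono_on {0..} (?\<beta> r)" if r: "0 \<le> r" for r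
  proof (rule monotone_onI)
    fix t t' :: real assume "t \<in> {0..}" "t' \<in> {0..}" "t \<le> t'"
    then show "?\<beta> r t' \<le> ?\<beta> r t"
      using monotone_onD[OF anti] r
      by (intro add_mono dilation_average_mono mono mult_right_mono) auto
  qed
  have L: "(?\<beta> r \<longlongrightarrow> 0) at_top" if r: "0 \<le> r" for r
  proof (rule tendsto_sandwich[OF _ _ tendsto_const])
    show "\<forall>\<^sub>F t in at_top. 0 \<le> ?\<beta> r t"
      using eventually_ge_at_top[of 0] by eventually_elim (rule class_K_nonneg[OF K r])
    show "\<forall>\<^sub>F t in at_top. ?\<beta> r t \<le> \<psi> (2 * r) t + exp (- t) * r"
      using eventually_ge_at_top[of 0]
      by eventually_elim (use dilation_average_bounds(2)[OF mono r] in auto)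
    have "((\<lambda>t::real. exp (- t)) \<longlongrightarrow> 0) at_top"
      by (intro filterlim_compose[OF exp_at_bot] filterlim_uminus_at_bot_at_top)
    then show "((\<lambda>t. \<psi> (2 * r) t + exp (- t) * r) \<longlongrightarrow> 0) at_top"
      using tendsto_add[OF lim[of "2 * r"] tendsto_mult_left_zero[of _ _ r]] r by simp
  qed
  show "class_KL ?\<beta>"
    using K A L by (simp add: class_KL_def)
  show "\<psi> r t \<le> ?\<beta> r t" if "0 \<le> r" "0 \<le> t" for r t
    using dilation_average_bounds(1)[OF mono[OF that(2)] that(1)] that
    by (simp add: add_increasing2)
qed

section \<open>Forward complete systems\<close>

locale forward_complete_system =
  fixes \<Sigma> :: "('x::real_normed_vector, 'v::real_vector) input_system"
    and N :: "(real \<Rightarrow> 'v) \<Rightarrow> ennreal"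
  assumes system: "system_with_inputs \<Sigma>"
    and complete: "forward_complete \<Sigma>"
    and admissible: "admissible_functional \<Sigma> N"
begin

abbreviation \<phi> :: "real \<Rightarrow> real \<Rightarrow> 'x \<Rightarrow> (real \<Rightarrow> 'v) \<Rightarrow> 'x" where
  "\<phi> \<equiv> flow \<Sigma>"

abbreviation \<U> :: "(real \<Rightarrow> 'v) set" where
  "\<U> \<equiv> inputs \<Sigma>"

lemma zero_input_in: "zero_input \<in> \<U>"
  using system by (simp add: system_with_inputs_def)

lemma N_zero_input: "N zero_input = 0"
  using admissible by (simp add: admissible_functional_def)

lemma flow_dom_iff: "(t, s, x, u) \<in> flow_dom \<Sigma> \<longleftrightarrow> 0 \<le> s \<and> s \<le> t \<and> u \<in> \<U>"
proof
  assume "(t, s, x, u) \<in> flow_dom \<Sigma>"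
  then show "0 \<le> s \<and> s \<le> t \<and> u \<in> \<U>"
    using system by (auto simp: system_with_inputs_def)
next
  assume *: "0 \<le> s \<and> s \<le> t \<and> u \<in> \<U>"
  then have "{t. (t, s, x, u) \<in> flow_dom \<Sigma>} = {t. s \<le> t \<and> ereal t < max_time \<Sigma> s x u}"
    using system by (simp add: system_with_inputs_def)
  moreover have "max_time \<Sigma> s x u = \<infinity>"
    using complete * by (simp add: forward_complete_def)
  ultimately show "(t, s, x, u) \<in> flow_dom \<Sigma>"
    using * by auto
qed

lemma flow_initial: "0 \<le> t \<Longrightarrow> u \<in> \<U> \<Longrightarrow> \<phi> t t x u = x"
  using system by (simp add: system_with_inputs_def)

lemma flow_causal:
  assumes "0 \<le> s" "s \<le> t" "u \<in> \<U>" "v \<in> \<U>" "\<And>\<tau>. s < \<tau> \<Longrightarrow> \<tau> \<le> t \<Longrightarrow> v \<tau> = u \<tau>"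
  shows "\<phi> t s x v = \<phi> t s x u"
proof (cases "s = t")
  case True
  then show ?thesis using assms flow_initial by simp
next
  case False
  have "\<forall>t s x u v. (t, s, x, u) \<in> flow_dom \<Sigma> \<and> s < t \<and> v \<in> \<U> \<and> (\<forall>\<tau>\<in>{s<..t}. v \<tau> = u \<tau>) \<longrightarrow>
        (t, s, x, v) \<in> flow_dom \<Sigma> \<and> \<phi> t s x v = \<phi> t s x u"
    using system unfolding system_with_inputs_def by (elim conjE)
  then show ?thesis using assms False by (auto simp: flow_dom_iff)
qed

lemma flow_semigroup:
  assumes "0 \<le> s" "s \<le> \<tau>" "\<tau> \<le> t" "u \<in> \<U>"
  shows "\<phi> t \<tau> (\<phi> \<tau> s x u) u = \<phi> t s x u"
proof (cases "s = \<tau> \<or> \<tau> = t")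
  case True
  then show ?thesis using assms flow_initial by auto
next
  case False
  have "\<forall>t s x u \<tau>. (t, s, x, u) \<in> flow_dom \<Sigma> \<and> s < \<tau> \<and> \<tau> < t \<longrightarrow>
        (t, \<tau>, \<phi> \<tau> s x u, u) \<in> flow_dom \<Sigma> \<and> \<phi> t \<tau> (\<phi> \<tau> s x u) u = \<phi> t s x u"
    using system unfolding system_with_inputs_def by (elim conjE)
  then show ?thesis using assms False by (auto simp: flow_dom_iff)
qed

lemma concat_input_in: "u \<in> \<U> \<Longrightarrow> v \<in> \<U> \<Longrightarrow> 0 \<le> t \<Longrightarrow> concat_input t u v \<in> \<U>"
  using system by (simp add: system_with_inputs_def)

lemma restrict_input_in:
  assumes "0 \<le> s" "s \<le> t" "u \<in> \<U>"
  shows "restrict_input {s<..t} u \<in> \<U>"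
proof -
  have "restrict_input {s<..t} u = concat_input s zero_input (concat_input t u zero_input)"
    using assms by (auto simp: restrict_input_def concat_input_def zero_input_def)
  then show ?thesis
    using assms zero_input_in by (simp add: concat_input_in)
qed

text \<open>
  Causality lets the input be replaced by its restriction to the current window, whose functional value
  may be far smaller than that of the whole input.
\<close>

lemma flow_restrict_input:
  assumes "0 \<le> s" "s \<le> t" "u \<in> \<U>"
  shows "\<phi> t s x (restrict_input {s<..t} u) = \<phi> t s x u"
  using assms by (intro flow_causal restrict_input_in) (auto simp: restrict_input_def)

lemma N_restrict_input_le:
  assumes "0 \<le> s" "s < t" "u \<in> \<U>"
  shows "N (restrict_input {s<..t} u) \<le> N u"
proof -
  have "N (restrict_input {s<..t} u) \<le> N (restrict_input {s<..} u)"
    "N (restrict_input {s<..} u) \<le> N u"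
    using admissible assms unfolding admissible_functional_def by auto
  then show ?thesis by (rule order_trans)
qed

end

section \<open>Consequences of iISS and of UBEBS\<close>

context forward_complete_system
begin

lemma iISS_imp_zero_GUAS:
  assumes "iISS \<Sigma> N"
  shows "zero_GUAS \<Sigma>"
proof -
  obtain \<beta> \<rho> where \<beta>: "class_KL \<beta>" and \<rho>: "class_Kinf \<rho>" and
    bound: "\<And>t0 t x0 u. 0 \<le> t0 \<Longrightarrow> t0 \<le> t \<Longrightarrow> u \<in> \<U> \<Longrightarrow>
      ennreal (norm (\<phi> t t0 x0 u)) \<le> ennreal (\<beta> (norm x0) (t - t0)) + gain_ext \<rho> (N u)"
    using assms unfolding iISS_def by blast
  have \<rho>0: "gain_ext \<rho> (N zero_input) = 0"
    using \<rho> by (simp add: gain_ext_def N_zero_input class_Kinf_def class_K_def)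
  have "norm (\<phi> t t0 x0 zero_input) \<le> \<beta> (norm x0) (t - t0)" if "0 \<le> t0" "t0 \<le> t" for t0 t x0
  proof -
    have "0 \<le> \<beta> (norm x0) (t - t0)"
      using \<beta> that by (auto simp: class_KL_def intro!: class_K_nonneg[of "\<lambda>r. \<beta> r (t - t0)"])
    then show ?thesis
      using bound[OF that zero_input_in, of x0] by (simp add: \<rho>0)
  qed
  then show ?thesis
    unfolding zero_GUAS_def using \<beta> zero_input_in by (auto simp: flow_dom_iff)
qed

lemma iISS_imp_UBEBS:
  assumes "iISS \<Sigma> N"
  shows "UBEBS \<Sigma> N"
proof -
  obtain \<beta> \<rho> where \<beta>: "class_KL \<beta>" and \<rho>: "class_Kinf \<rho>" and
    bound: "\<And>t0 t x0 u. 0 \<le> t0 \<Longrightarrow> t0 \<le> t \<Longrightarrow> u \<in> \<U> \<Longrightarrow>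
      ennreal (norm (\<phi> t t0 x0 u)) \<le> ennreal (\<beta> (norm x0) (t - t0)) + gain_ext \<rho> (N u)"
    using assms unfolding iISS_def by blast
  define \<alpha> where "\<alpha> r = \<beta> r 0 + r" for r
  have K: "class_K (\<lambda>r. \<beta> r 0)" using \<beta> by (simp add: class_KL_def)
  have "class_K \<alpha>"
    using K class_K_nonneg[OF K] unfolding class_K_def \<alpha>_def
    by (auto intro!: continuous_intros strict_mono_onI add_strict_mono add_nonneg_nonneg
        dest: strict_mono_onD)
  then have \<alpha>: "class_Kinf \<alpha>"
    by (rule class_Kinf_if_ge_linear[of _ 1]) (use class_K_nonneg[OF K] in \<open>auto simp: \<alpha>_def\<close>)
  have "\<beta> (norm x0) (t - t0) \<le> \<alpha> (norm x0)" if "t0 \<le> t" for t0 t and x0 :: 'x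
  proof -
    have "antimono_on {0..} (\<beta> (norm x0))" using \<beta> by (simp add: class_KL_def)
    from monotone_onD[OF this, of 0 "t - t0"] show ?thesis
      using that by (simp add: \<alpha>_def add_increasing2)
  qed
  then have "ennreal (norm (\<phi> t t0 x0 u)) \<le> ennreal 0 + ennreal (\<alpha> (norm x0)) + gain_ext \<rho> (N u)"
    if "0 \<le> t0" "t0 \<le> t" "u \<in> \<U>" for t0 t x0 u
    using order_trans[OF bound[OF that] add_right_mono[OF ennreal_leI]] that by simp
  then show ?thesis
    unfolding UBEBS_def using complete \<alpha> \<rho>
    by (intro conjI exI[of _ \<alpha>] exI[of _ \<rho>] exI[of _ "0::real"]) auto
qed

text \<open>
  This is the form in which UBEBS enters the converse implication: the gains are monotone, so a bound
  on the data bounds the whole reachable set.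
\<close>

lemma UBEBS_imp_bounded_reachable:
  assumes "UBEBS \<Sigma> N"
  shows "\<exists>B. \<forall>t0\<ge>0. \<forall>t\<ge>t0. \<forall>x0. \<forall>u\<in>\<U>.
           norm x0 \<le> R \<longrightarrow> N u \<le> ennreal R \<longrightarrow> norm (\<phi> t t0 x0 u) \<le> B"
proof -
  obtain \<alpha> \<rho> c where Kinf: "class_Kinf \<alpha>" "class_Kinf \<rho>" and c: "0 \<le> c" and
    bound: "\<And>t0 t x0 u. 0 \<le> t0 \<Longrightarrow> t0 \<le> t \<Longrightarrow> u \<in> \<U> \<Longrightarrow>
      ennreal (norm (\<phi> t t0 x0 u)) \<le> ennreal c + ennreal (\<alpha> (norm x0)) + gain_ext \<rho> (N u)"
    using assms unfolding UBEBS_def by blast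
  then have \<alpha>: "class_K \<alpha>" and \<rho>: "class_K \<rho>" by (simp_all add: class_Kinf_def)
  have "norm (\<phi> t t0 x0 u) \<le> c + \<alpha> R + \<rho> R"
    if *: "0 \<le> t0" "t0 \<le> t" "u \<in> \<U>" "norm x0 \<le> R" "N u \<le> ennreal R" for t0 t x0 u
  proof -
    have R: "0 \<le> R" using *(4) norm_ge_zero order_trans by blast
    have fin: "N u \<noteq> \<infinity>" using *(5) by (auto simp: top_unique)
    have "enn2real (N u) \<le> R" using enn2real_mono[OF *(5)] R by simp
    then have "gain_ext \<rho> (N u) \<le> ennreal (\<rho> R)"
      using fin by (auto simp: gain_ext_def intro!: ennreal_leI class_K_mono[OF \<rho>])
    moreover have "ennreal (\<alpha> (norm x0)) \<le> ennreal (\<alpha> R)"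
      by (intro ennreal_leI class_K_mono[OF \<alpha>] *) simp
    ultimately have "ennreal (norm (\<phi> t t0 x0 u)) \<le> ennreal c + ennreal (\<alpha> R) + ennreal (\<rho> R)"
      using order_trans[OF bound[OF *(1-3)]] by (meson add_mono order_refl)
    also have "\<dots> = ennreal (c + \<alpha> R + \<rho> R)"
      using c class_K_nonneg[OF \<alpha> R] class_K_nonneg[OF \<rho> R] by simp
    finally show ?thesis
      by (rule iffD1[OF ennreal_le_iff, rotated])
        (use c class_K_nonneg[OF \<alpha> R] class_K_nonneg[OF \<rho> R] in simp)
  qed
  then show ?thesis by blast
qed

end

section \<open>Comparison with the zero input\<close>

text \<open>
  The setting of the converse implication, with UBEBS in the form of bounded reachability and \<open>\<beta>\<close> a
  witness of 0-GUAS.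
\<close>

locale bounded_zero_GUAS_system = forward_complete_system \<Sigma> N
  for \<Sigma> :: "('x::real_normed_vector, 'v::real_vector) input_system"
    and N :: "(real \<Rightarrow> 'v) \<Rightarrow> ennreal" +
  fixes \<beta> :: "real \<Rightarrow> real \<Rightarrow> real"
  assumes superadditive: "\<And>u t1 t2 t3. u \<in> \<U> \<Longrightarrow> 0 \<le> t1 \<Longrightarrow> t1 < t2 \<Longrightarrow> t2 < t3 \<Longrightarrow>
           N (restrict_input {t1<..t2} u) + N (restrict_input {t2<..t3} u)
             \<le> N (restrict_input {t1<..t3} u)"
    and continuity: "\<And>r \<epsilon> T :: real. r > 0 \<Longrightarrow> \<epsilon> > 0 \<Longrightarrow> T > 0 \<Longrightarrow>
           \<exists>\<delta>>0. \<forall>t0\<ge>0. \<forall>x0. \<forall>u\<in>\<U>. N u \<le> ennreal \<delta> \<longrightarrow>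
             (\<forall>t'\<in>{t0..t0 + T}.
                (\<forall>t\<in>{t0..t'}. norm (\<phi> t t0 x0 u) \<le> r \<and> norm (\<phi> t t0 x0 zero_input) \<le> r) \<longrightarrow>
                (\<forall>t\<in>{t0..t'}. norm (\<phi> t t0 x0 zero_input - \<phi> t t0 x0 u) \<le> \<epsilon>))"
    and KL: "class_KL \<beta>"
    and zero_input_bound: "\<And>t0 t x0. 0 \<le> t0 \<Longrightarrow> t0 \<le> t \<Longrightarrow>
           norm (\<phi> t t0 x0 zero_input) \<le> \<beta> (norm x0) (t - t0)"
    and bounded_reachable: "\<And>R. \<exists>B. \<forall>t0\<ge>0. \<forall>t\<ge>t0. \<forall>x0. \<forall>u\<in>\<U>.
           norm x0 \<le> R \<longrightarrow> N u \<le> ennreal R \<longrightarrow> norm (\<phi> t t0 x0 u) \<le> B"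
begin

lemma \<beta>_class_K: "0 \<le> t \<Longrightarrow> class_K (\<lambda>r. \<beta> r t)"
  using KL by (simp add: class_KL_def)

lemma \<beta>_mono:
  assumes "0 \<le> r" "r \<le> r'" "0 \<le> t" "t \<le> t'"
  shows "\<beta> r t' \<le> \<beta> r' t"
proof -
  have "antimono_on {0..} (\<beta> r)" using KL assms by (simp add: class_KL_def)
  from monotone_onD[OF this, of t t'] have "\<beta> r t' \<le> \<beta> r t" using assms by simp
  also have "\<dots> \<le> \<beta> r' t" by (rule class_K_mono[OF \<beta>_class_K]) (use assms in auto)
  finally show ?thesis .
qed

lemma \<beta>_eventually_small:
  assumes "0 \<le> r" "0 < \<epsilon>"
  obtains T where "0 < T" "\<beta> r T \<le> \<epsilon>"
proof -
  have "(\<beta> r \<longlongrightarrow> 0) at_top" using KL assms by (simp add: class_KL_def)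
  then have "\<forall>\<^sub>F t in at_top. \<beta> r t < \<epsilon>" using assms by (auto dest: order_tendstoD)
  then have "\<forall>\<^sub>F t in at_top. 0 < t \<and> \<beta> r t < \<epsilon>"
    using eventually_gt_at_top[of 0] by eventually_elim auto
  then obtain T where "0 < T \<and> \<beta> r T < \<epsilon>"
    using eventually_happens by fastforce
  then show ?thesis using that[of T] by simp
qed

text \<open>
  The continuity assumption compares two trajectories only as long as both are known to stay in a
  ball. Bounded reachability supplies a ball for the whole window before \<open>\<delta>\<close> has to be chosen, provided
  that \<open>\<delta> \<le> 1\<close>.
\<close>

lemma close_to_zero_input_flow:
  assumes "0 < \<epsilon>" "0 < T"
  obtains \<delta> where "0 < \<delta>"
    "\<And>t0 t x0 u. 0 \<le> t0 \<Longrightarrow> t0 \<le> t \<Longrightarrow> t \<le> t0 + T \<Longrightarrow> norm x0 \<le> M \<Longrightarrow> u \<in> \<U> \<Longrightarrow>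
       N u \<le> ennreal \<delta> \<Longrightarrow> norm (\<phi> t t0 x0 u) \<le> \<beta> (norm x0) (t - t0) + \<epsilon>"
proof -
  obtain B where B: "\<And>t0 t x0 u. 0 \<le> t0 \<Longrightarrow> t0 \<le> t \<Longrightarrow> u \<in> \<U> \<Longrightarrow> norm x0 \<le> max M 1 \<Longrightarrow>
      N u \<le> ennreal (max M 1) \<Longrightarrow> norm (\<phi> t t0 x0 u) \<le> B"
    using bounded_reachable[of "max M 1"] by blast
  have "0 < max B 1" by simp
  from continuity[OF this assms] obtain \<delta> where \<delta>: "0 < \<delta>" and
    close: "\<And>t0 x0 u t' t. 0 \<le> t0 \<Longrightarrow> u \<in> \<U> \<Longrightarrow> N u \<le> ennreal \<delta> \<Longrightarrow> t' \<in> {t0..t0 + T} \<Longrightarrow>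
      \<forall>t\<in>{t0..t'}. norm (\<phi> t t0 x0 u) \<le> max B 1 \<and> norm (\<phi> t t0 x0 zero_input) \<le> max B 1 \<Longrightarrow>
      t \<in> {t0..t'} \<Longrightarrow> norm (\<phi> t t0 x0 zero_input - \<phi> t t0 x0 u) \<le> \<epsilon>"
    by blast
  show ?thesis
  proof (rule that[of "min \<delta> 1"])
    fix t0 t :: real and x0 :: 'x and u :: "real \<Rightarrow> 'v"
    assume t: "0 \<le> t0" "t0 \<le> t" "t \<le> t0 + T" and x0: "norm x0 \<le> M" and u: "u \<in> \<U>"
      and Nu: "N u \<le> ennreal (min \<delta> 1)"
    have Nu': "N u \<le> ennreal \<delta>" "N u \<le> ennreal (max M 1)"
      by (rule order_trans[OF Nu], simp add: ennreal_leI)+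
    have "\<forall>s\<in>{t0..t}. norm (\<phi> s t0 x0 u) \<le> max B 1 \<and> norm (\<phi> s t0 x0 zero_input) \<le> max B 1"
      using B[of t0 _ u x0] B[of t0 _ zero_input x0] t x0 u Nu'(2) zero_input_in N_zero_input
      by (force simp: le_max_iff_disj)
    from close[OF t(1) u Nu'(1) _ this, of t]
    have "norm (\<phi> t t0 x0 zero_input - \<phi> t t0 x0 u) \<le> \<epsilon>"
      using t by auto
    then have "norm (\<phi> t t0 x0 u) \<le> norm (\<phi> t t0 x0 zero_input) + \<epsilon>"
      using norm_triangle_sub[of "\<phi> t t0 x0 u" "\<phi> t t0 x0 zero_input"]
      by (simp add: norm_minus_commute)
    then show "norm (\<phi> t t0 x0 u) \<le> \<beta> (norm x0) (t - t0) + \<epsilon>"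
      using zero_input_bound[OF t(1,2), of x0] by simp
  qed (use \<delta> in simp)
qed

text \<open>
  Choose a radius \<open>\<eta>\<close> whose zero-input bound is below \<open>\<epsilon> / 2\<close>, and windows long enough for that bound to
  fall to \<open>\<eta> / 2\<close>. A perturbation of at most \<open>\<eta> / 2\<close> per window then brings the state back into the
  ball of radius \<open>\<eta>\<close> at every window end, so errors do not accumulate.
\<close>

lemma small_data_small_flow:
  assumes \<epsilon>: "0 < \<epsilon>"
  obtains \<delta> where "0 < \<delta>"
    "\<And>t0 t x0 u. 0 \<le> t0 \<Longrightarrow> t0 \<le> t \<Longrightarrow> norm x0 \<le> \<delta> \<Longrightarrow> u \<in> \<U> \<Longrightarrow> N u \<le> ennreal \<delta> \<Longrightarrow>
       norm (\<phi> t t0 x0 u) \<le> \<epsilon>"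
proof -
  obtain \<eta> where \<eta>: "0 < \<eta>" "\<beta> \<eta> 0 \<le> \<epsilon> / 2"
    using class_K_small[OF \<beta>_class_K, of 0 "\<epsilon> / 2"] \<epsilon> by auto
  obtain T where T: "0 < T" "\<beta> \<eta> T \<le> \<eta> / 2"
    using \<beta>_eventually_small[of \<eta> "\<eta> / 2"] \<eta> by auto
  obtain \<delta> where \<delta>: "0 < \<delta>" and close:
    "\<And>t0 t x0 u. 0 \<le> t0 \<Longrightarrow> t0 \<le> t \<Longrightarrow> t \<le> t0 + T \<Longrightarrow> norm x0 \<le> \<eta> \<Longrightarrow> u \<in> \<U> \<Longrightarrow>
       N u \<le> ennreal \<delta> \<Longrightarrow> norm (\<phi> t t0 x0 u) \<le> \<beta> (norm x0) (t - t0) + min (\<eta> / 2) (\<epsilon> / 2)"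
    using close_to_zero_input_flow[of "min (\<eta> / 2) (\<epsilon> / 2)" T \<eta>] \<eta> \<epsilon> T by auto
  show ?thesis
  proof (rule that[of "min \<eta> \<delta>"])
    fix t0 t :: real and x0 :: 'x and u :: "real \<Rightarrow> 'v"
    assume t: "0 \<le> t0" "t0 \<le> t" and x0: "norm x0 \<le> min \<eta> \<delta>" and u: "u \<in> \<U>"
      and Nu: "N u \<le> ennreal (min \<eta> \<delta>)"
    have Nu': "N u \<le> ennreal \<delta>"
      by (rule order_trans[OF Nu]) (simp add: ennreal_leI)
    define s where "s n = t0 + real n * T" for n
    have s: "0 \<le> s n" "t0 \<le> s n" "s (Suc n) = s n + T" for n
      using t T by (auto simp: s_def algebra_simps)
    have ret: "norm (\<phi> (s n) t0 x0 u) \<le> \<eta>" for n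
    proof (induction n)
      case 0
      then show ?case using x0 t u by (simp add: s_def flow_initial)
    next
      case (Suc n)
      let ?y = "\<phi> (s n) t0 x0 u"
      have "norm (\<phi> (s (Suc n)) (s n) ?y u) \<le> \<beta> (norm ?y) T + \<eta> / 2"
        using close[OF s(1)[of n] _ _ Suc u Nu', of "s (Suc n)"] T s(3)[of n] by simp
      also have "\<dots> \<le> \<eta>"
        using \<beta>_mono[of "norm ?y" \<eta> T T] Suc T by simp
      finally show ?case
        using flow_semigroup[OF t(1) s(2)[of n], of "s (Suc n)"] s(3)[of n] T u by simp
    qed
    define n where "n = nat \<lfloor>(t - t0) / T\<rfloor>"
    have "real n \<le> (t - t0) / T" "(t - t0) / T < real n + 1"
      using t T unfolding n_def by (simp_all add: of_nat_nat)
    then have n: "s n \<le> t" "t \<le> s n + T"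
      using T by (auto simp: s_def field_simps)
    let ?y = "\<phi> (s n) t0 x0 u"
    have "norm (\<phi> t (s n) ?y u) \<le> \<beta> (norm ?y) (t - s n) + \<epsilon> / 2"
      using close[OF s(1)[of n] n ret[of n] u Nu'] by simp
    also have "\<dots> \<le> \<epsilon>"
      using \<beta>_mono[of "norm ?y" \<eta> 0 "t - s n"] ret[of n] n \<eta> by simp
    finally show "norm (\<phi> t t0 x0 u) \<le> \<epsilon>"
      using flow_semigroup[OF t(1) s(2) n(1) u] by simp
  qed (use \<eta> \<delta> in simp)
qed

text \<open>
  Let \<open>\<omega> r\<close> be the largest norm reachable when the initial state and the input have size at most \<open>r\<close>. It is
  finite by bounded reachability and tends to \<open>0\<close> with \<open>r\<close> by the behaviour for small data, so it has
  a majorant \<open>\<sigma>\<close> of class \<open>\<K>\<^sub>\<infinity>\<close>. A maximum of two arguments then splits into a sum of two values.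
\<close>

lemma Kinf_bound:
  obtains \<sigma> where "class_Kinf \<sigma>"
    "\<And>t0 t x0 u. 0 \<le> t0 \<Longrightarrow> t0 \<le> t \<Longrightarrow> u \<in> \<U> \<Longrightarrow> N u < \<infinity> \<Longrightarrow>
       norm (\<phi> t t0 x0 u) \<le> \<sigma> (norm x0) + \<sigma> (enn2real (N u))"
proof -
  define S where "S r = {norm (\<phi> t t0 x0 u) | t0 t x0 u.
      0 \<le> t0 \<and> t0 \<le> t \<and> u \<in> \<U> \<and> norm x0 \<le> r \<and> N u \<le> ennreal r}" for r
  define \<omega> where "\<omega> r = Sup (S r)" for r
  have bdd: "bdd_above (S r)" for r
    using bounded_reachable[of r] unfolding S_def bdd_above_def by blast
  have zero: "0 \<in> S r" if "0 \<le> r" for r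
    using that zero_input_in N_zero_input flow_initial[of 0 zero_input 0] unfolding S_def
    by (intro CollectI exI[of _ 0] exI[of _ zero_input]) auto
  have sub: "S r \<subseteq> S r'" if "r \<le> r'" for r r'
  proof
    fix p assume "p \<in> S r"
    then obtain t0 t x0 u where *: "p = norm (\<phi> t t0 x0 u)" "0 \<le> t0" "t0 \<le> t" "u \<in> \<U>"
      "norm x0 \<le> r" "N u \<le> ennreal r"
      unfolding S_def by blast
    have "norm x0 \<le> r'" "N u \<le> ennreal r'"
      using *(5) that order_trans[OF *(6) ennreal_leI[OF that]] by simp_all
    then show "p \<in> S r'" unfolding S_def using *(1-4) by blast
  qed
  have mono: "mono_on {0..} \<omega>"
  proof (rule mono_onI)
    fix r r' :: real assume "r \<in> {0..}" "r' \<in> {0..}" "r \<le> r'"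
    then have "0 \<in> S r" "S r \<subseteq> S r'" using zero sub by auto
    then show "\<omega> r \<le> \<omega> r'"
      unfolding \<omega>_def using bdd by (intro cSup_subset_mono) auto
  qed
  have nonneg: "0 \<le> \<omega> r" if "0 \<le> r" for r
    unfolding \<omega>_def using zero[OF that] bdd by (rule cSup_upper)
  have small: "\<exists>\<delta>>0. \<omega> \<delta> \<le> \<epsilon>" if "0 < \<epsilon>" for \<epsilon>
  proof -
    obtain \<delta> where \<delta>: "0 < \<delta>"
      "\<And>t0 t x0 u. 0 \<le> t0 \<Longrightarrow> t0 \<le> t \<Longrightarrow> norm x0 \<le> \<delta> \<Longrightarrow> u \<in> \<U> \<Longrightarrow> N u \<le> ennreal \<delta> \<Longrightarrow>
         norm (\<phi> t t0 x0 u) \<le> \<epsilon>"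
      using small_data_small_flow[OF \<open>0 < \<epsilon>\<close>] by blast
    have "p \<le> \<epsilon>" if "p \<in> S \<delta>" for p
      using that \<delta>(2) unfolding S_def by blast
    moreover have "S \<delta> \<noteq> {}" using zero[of \<delta>] \<delta>(1) by auto
    ultimately have "\<omega> \<delta> \<le> \<epsilon>"
      unfolding \<omega>_def by (intro cSup_least)
    then show ?thesis using \<delta>(1) by blast
  qed
  have \<omega>0: "\<omega> 0 = 0"
  proof (rule antisym)
    show "\<omega> 0 \<le> 0"
    proof (rule field_le_epsilon)
      fix \<epsilon> :: real assume "0 < \<epsilon>"
      then obtain \<delta> where "0 < \<delta>" "\<omega> \<delta> \<le> \<epsilon>" using small by blast
      then show "\<omega> 0 \<le> 0 + \<epsilon>" using mono_onD[OF mono, of 0 \<delta>] by simp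
    qed
  qed (simp add: nonneg)
  have lim: "(\<omega> \<longlongrightarrow> 0) (at_right 0)"
  proof (rule order_tendstoI)
    fix a :: real assume "a < 0"
    then have "a < \<omega> r" if "0 < r" for r
      using nonneg[of r] that by simp
    then show "\<forall>\<^sub>F r in at_right 0. a < \<omega> r"
      by (simp add: eventually_at_filter)
  next
    fix a :: real assume "0 < a"
    then obtain \<delta> where \<delta>: "0 < \<delta>" "\<omega> \<delta> \<le> a / 2" using small[of "a / 2"] by auto
    have "\<omega> r < a" if "0 < r" "r < \<delta>" for r
      using mono_onD[OF mono, of r \<delta>] that \<delta> \<open>0 < a\<close> by simp
    then show "\<forall>\<^sub>F r in at_right 0. \<omega> r < a"
      using \<delta>(1) by (auto simp: eventually_at_right_field)
  qed
  obtain \<sigma> where \<sigma>: "class_Kinf \<sigma>" "\<And>r. 0 \<le> r \<Longrightarrow> \<omega> r \<le> \<sigma> r"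
    using Kinf_majorant[OF mono \<omega>0 lim] by blast
  then have K: "class_K \<sigma>" by (simp add: class_Kinf_def)
  show ?thesis
  proof (rule that[OF \<sigma>(1)])
    fix t0 t :: real and x0 :: 'x and u :: "real \<Rightarrow> 'v"
    assume *: "0 \<le> t0" "t0 \<le> t" "u \<in> \<U>" "N u < \<infinity>"
    define R where "R = max (norm x0) (enn2real (N u))"
    have "ennreal (enn2real (N u)) = N u" using * by simp
    then have "N u \<le> ennreal R"
      unfolding R_def by (metis ennreal_leI max.cobounded2)
    moreover have "norm x0 \<le> R" by (simp add: R_def)
    ultimately have "norm (\<phi> t t0 x0 u) \<in> S R"
      using * unfolding S_def by blast
    then have "norm (\<phi> t t0 x0 u) \<le> \<omega> R"
      unfolding \<omega>_def using bdd by (intro cSup_upper)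
    also have "\<dots> \<le> \<sigma> R"
      by (rule \<sigma>(2)) (simp add: R_def le_max_iff_disj)
    also have "\<dots> \<le> \<sigma> (norm x0) + \<sigma> (enn2real (N u))"
      using class_K_nonneg[OF K, of "norm x0"] class_K_nonneg[OF K, of "enn2real (N u)"]
      by (simp add: R_def max_def)
    finally show "norm (\<phi> t t0 x0 u) \<le> \<sigma> (norm x0) + \<sigma> (enn2real (N u))" .
  qed
qed

text \<open>
  Pigeonhole principle: by superadditivity, \<open>K\<close> consecutive windows on each of which the input exceeds
  \<open>\<delta>\<close> would add up to at least \<open>K * \<delta> > R\<close>.
\<close>

lemma quiet_interval:
  assumes u: "u \<in> \<U>" "N u \<le> ennreal R" and "0 \<le> R" "R < real K * \<delta>" "0 < \<delta>" "0 \<le> t0" "0 < T"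
  obtains k where "k < K"
    "N (restrict_input {t0 + real k * T<..t0 + real (Suc k) * T} u) \<le> ennreal \<delta>"
proof -
  define s where "s k = t0 + real k * T" for k
  have s: "0 \<le> s k" "s k < s (Suc k)" "t0 < s (Suc k)" for k
    using assms by (auto simp: s_def add_nonneg_pos)
  have "\<exists>k<K. N (restrict_input {s k<..s (Suc k)} u) \<le> ennreal \<delta>"
  proof (rule ccontr)
    assume "\<not> ?thesis"
    then have big: "ennreal \<delta> \<le> N (restrict_input {s k<..s (Suc k)} u)" if "k < K" for k
      using that by (meson less_imp_le not_le)
    have "ennreal (real (Suc k) * \<delta>) \<le> N (restrict_input {t0<..s (Suc k)} u)" if "k < K" for k
      using that
    proof (induction k)
      case 0
      then show ?case using big[of 0] by (simp add: s_def)
    next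
      case (Suc k)
      have "ennreal (real (Suc (Suc k)) * \<delta>) = ennreal (real (Suc k) * \<delta>) + ennreal \<delta>"
        using assms by (subst ennreal_plus[symmetric]) (auto simp: algebra_simps)
      also have "\<dots> \<le> N (restrict_input {t0<..s (Suc k)} u)
          + N (restrict_input {s (Suc k)<..s (Suc (Suc k))} u)"
        using Suc big by (intro add_mono) auto
      also have "\<dots> \<le> N (restrict_input {t0<..s (Suc (Suc k))} u)"
        using assms s by (intro superadditive) auto
      finally show ?case .
    qed
    moreover obtain k where k: "K = Suc k" using assms by (cases K) auto
    ultimately have "ennreal (real K * \<delta>) \<le> N (restrict_input {t0<..s K} u)"
      by simp
    also have "\<dots> \<le> N u"
      using assms s(3)[of k] k by (intro N_restrict_input_le) auto
    also have "\<dots> \<le> ennreal R" by fact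
    finally show False using assms by (simp add: ennreal_le_iff)
  qed
  then show ?thesis using that unfolding s_def by blast
qed

text \<open>
  The whole trajectory stays in the ball of radius \<open>M = 2 * \<sigma> R\<close>. A window of length \<open>T\<close> suffices to bring
  any state of that ball below \<open>\<eta>\<close> if the input is quiet there; from the end of a quiet window on, the
  \<open>\<sigma>\<close>-bound contributes only \<open>\<sigma> \<eta> \<le> \<epsilon>\<close> on account of the state, however large the remaining input is.
\<close>

lemma uniform_attractivity:
  assumes \<sigma>: "class_K \<sigma>"
    "\<And>t0 t x0 u. 0 \<le> t0 \<Longrightarrow> t0 \<le> t \<Longrightarrow> u \<in> \<U> \<Longrightarrow> N u < \<infinity> \<Longrightarrow>
       norm (\<phi> t t0 x0 u) \<le> \<sigma> (norm x0) + \<sigma> (enn2real (N u))"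
    and "0 < \<epsilon>" "0 \<le> R"
  obtains T where "0 \<le> T"
    "\<And>t0 t x0 u. 0 \<le> t0 \<Longrightarrow> t0 + T \<le> t \<Longrightarrow> u \<in> \<U> \<Longrightarrow> norm x0 \<le> R \<Longrightarrow> N u \<le> ennreal R \<Longrightarrow>
       norm (\<phi> t t0 x0 u) \<le> \<epsilon> + \<sigma> (enn2real (N u))"
proof -
  define M where "M = 2 * \<sigma> R"
  have M: "0 \<le> M" using class_K_nonneg[OF \<sigma>(1)] assms by (simp add: M_def)
  obtain \<eta> where \<eta>: "0 < \<eta>" "\<sigma> \<eta> \<le> \<epsilon>"
    using class_K_small[OF \<sigma>(1) \<open>0 < \<epsilon>\<close>] by blast
  obtain T where T: "0 < T" "\<beta> M T \<le> \<eta> / 2"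
    using \<beta>_eventually_small[OF M, of "\<eta> / 2"] \<eta> by auto
  obtain \<delta> where \<delta>: "0 < \<delta>" and close:
    "\<And>t0 t x0 u. 0 \<le> t0 \<Longrightarrow> t0 \<le> t \<Longrightarrow> t \<le> t0 + T \<Longrightarrow> norm x0 \<le> M \<Longrightarrow> u \<in> \<U> \<Longrightarrow>
       N u \<le> ennreal \<delta> \<Longrightarrow> norm (\<phi> t t0 x0 u) \<le> \<beta> (norm x0) (t - t0) + \<eta> / 2"
    using close_to_zero_input_flow[of "\<eta> / 2" T M] \<eta> T by auto
  obtain K :: nat where K: "R < real K * \<delta>"
    using reals_Archimedean3[OF \<delta>] by blast
  show ?thesis
  proof (rule that[of "real K * T"])
    fix t0 t :: real and x0 :: 'x and u :: "real \<Rightarrow> 'v"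
    assume t: "0 \<le> t0" "t0 + real K * T \<le> t" and u: "u \<in> \<U>" and x0: "norm x0 \<le> R"
      and Nu: "N u \<le> ennreal R"
    obtain k where k: "k < K"
      "N (restrict_input {t0 + real k * T<..t0 + real (Suc k) * T} u) \<le> ennreal \<delta>"
      using quiet_interval[OF u Nu \<open>0 \<le> R\<close> K \<delta> t(1) T(1)] by blast
    define a where "a = t0 + real k * T"
    define b where "b = t0 + real (Suc k) * T"
    have "real (Suc k) * T \<le> real K * T" using k T by (intro mult_right_mono) auto
    then have ab: "0 \<le> a" "t0 \<le> a" "a \<le> b" "b = a + T" "b \<le> t"
      using t T by (auto simp: a_def b_def algebra_simps)
    define v where "v = restrict_input {a<..b} u"
    have v: "v \<in> \<U>" "N v \<le> ennreal \<delta>"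
      using k(2) restrict_input_in[OF ab(1,3) u] by (auto simp: v_def a_def b_def)
    have fin: "N u < \<infinity>" using Nu by (simp add: le_less_trans)
    have NuR: "enn2real (N u) \<le> R" using enn2real_mono[OF Nu] \<open>0 \<le> R\<close> by simp
    let ?y = "\<phi> a t0 x0 u"
    let ?z = "\<phi> b t0 x0 u"
    have y: "norm ?y \<le> M"
      using \<sigma>(2)[OF t(1) ab(2) u fin, of x0] class_K_mono[OF \<sigma>(1) _ x0]
        class_K_mono[OF \<sigma>(1) _ NuR] by (simp add: M_def)
    have "?z = \<phi> b a ?y v"
      using flow_semigroup[OF t(1) ab(2,3) u] flow_restrict_input[OF ab(1,3) u]
      by (simp add: v_def)
    also have "norm \<dots> \<le> \<beta> (norm ?y) T + \<eta> / 2"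
      using close[OF ab(1,3) _ y v] ab(4) by simp
    also have "\<dots> \<le> \<eta>" using \<beta>_mono[of "norm ?y" M T T] y T by simp
    finally have z: "norm ?z \<le> \<eta>" .
    have "norm (\<phi> t b ?z u) \<le> \<sigma> (norm ?z) + \<sigma> (enn2real (N u))"
      using ab u fin by (intro \<sigma>(2)) auto
    also have "\<sigma> (norm ?z) \<le> \<epsilon>"
      using class_K_mono[OF \<sigma>(1) _ z] \<eta> by simp
    finally show "norm (\<phi> t t0 x0 u) \<le> \<epsilon> + \<sigma> (enn2real (N u))"
      using flow_semigroup[of t0 b t u x0] t ab u by simp
  qed (use T in simp)
qed

text \<open>
  Let \<open>\<psi> r s\<close> be the largest excess of the norm of the state over \<open>\<sigma> |u|\<close> after time \<open>s\<close> when the initial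
  state and the input have size at most \<open>r\<close>; its class \<open>\<K>\<L>\<close> majorant serves trajectories with
  \<open>|u| \<le> |x0|\<close>. An input larger than the initial state dominates \<open>\<sigma> |x0|\<close>, which explains the
  gain \<open>2 * \<sigma>\<close>.
\<close>

lemma KL_Kinf_bound:
  obtains \<gamma> \<rho> where "class_KL \<gamma>" "class_Kinf \<rho>"
    "\<And>t0 t x0 u. 0 \<le> t0 \<Longrightarrow> t0 \<le> t \<Longrightarrow> u \<in> \<U> \<Longrightarrow> N u < \<infinity> \<Longrightarrow>
       norm (\<phi> t t0 x0 u) \<le> \<gamma> (norm x0) (t - t0) + \<rho> (enn2real (N u))"
proof -
  obtain \<sigma> where \<sigma>: "class_Kinf \<sigma>"
    "\<And>t0 t x0 u. 0 \<le> t0 \<Longrightarrow> t0 \<le> t \<Longrightarrow> u \<in> \<U> \<Longrightarrow> N u < \<infinity> \<Longrightarrow>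
       norm (\<phi> t t0 x0 u) \<le> \<sigma> (norm x0) + \<sigma> (enn2real (N u))"
    using Kinf_bound by blast
  then have K: "class_K \<sigma>" by (simp add: class_Kinf_def)
  have \<sigma>_nonneg: "0 \<le> \<sigma> r" if "0 \<le> r" for r using class_K_nonneg[OF K that] .
  have \<sigma>0: "\<sigma> 0 = 0" using K by (simp add: class_K_def)
  define P where "P r s = {norm (\<phi> t t0 x0 u) - \<sigma> (enn2real (N u)) | t0 t x0 u.
      0 \<le> t0 \<and> t0 + s \<le> t \<and> u \<in> \<U> \<and> norm x0 \<le> r \<and> N u \<le> ennreal r}" for r s
  define \<psi> where "\<psi> r s = Sup (P r s)" for r s
  have P_le: "p \<le> \<sigma> r" if p: "p \<in> P r s" and s: "0 \<le> s" for p r s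
  proof -
    obtain t0 t x0 u where *: "p = norm (\<phi> t t0 x0 u) - \<sigma> (enn2real (N u))" "0 \<le> t0" "t0 + s \<le> t"
      "u \<in> \<U>" "norm x0 \<le> r" "N u \<le> ennreal r"
      using p unfolding P_def by blast
    have "N u < \<infinity>" using *(6) by (simp add: le_less_trans)
    then show ?thesis
      using \<sigma>(2)[of t0 t u x0] class_K_mono[OF K _ *(5)] * s by simp
  qed
  have bdd: "bdd_above (P r s)" if "0 \<le> s" for r s
    using P_le[OF _ that] by (auto simp: bdd_above_def)
  have zero: "0 \<in> P r s" if "0 \<le> r" "0 \<le> s" for r s
  proof -
    have "norm (\<phi> s 0 0 zero_input) = 0"
      using \<sigma>(2)[of 0 s zero_input 0] that zero_input_in N_zero_input \<sigma>0 by simp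
    then show ?thesis
      using that zero_input_in N_zero_input \<sigma>0 unfolding P_def
      by (intro CollectI exI[of _ 0] exI[of _ s] exI[of _ zero_input]) auto
  qed
  have sub: "P r s \<subseteq> P r' s'" if "r \<le> r'" "s' \<le> s" for r r' s s'
  proof
    fix p assume "p \<in> P r s"
    then obtain t0 t x0 u where *: "p = norm (\<phi> t t0 x0 u) - \<sigma> (enn2real (N u))" "0 \<le> t0"
      "t0 + s \<le> t" "u \<in> \<U>" "norm x0 \<le> r" "N u \<le> ennreal r"
      unfolding P_def by blast
    have "norm x0 \<le> r'" "N u \<le> ennreal r'" "t0 + s' \<le> t"
      using *(3,5) that order_trans[OF *(6) ennreal_leI[OF that(1)]] by simp_all
    then show "p \<in> P r' s'" unfolding P_def using *(1,2,4) by blast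
  qed
  have nonneg: "0 \<le> \<psi> r s" if "0 \<le> r" "0 \<le> s" for r s
    unfolding \<psi>_def using zero bdd that by (intro cSup_upper) auto
  have le: "\<psi> r s \<le> \<sigma> r" if "0 \<le> r" "0 \<le> s" for r s
    unfolding \<psi>_def using zero[OF that] P_le that by (intro cSup_least) auto
  have mono: "mono_on {0..} (\<lambda>r. \<psi> r s)" if "0 \<le> s" for s
  proof (rule mono_onI)
    fix r r' :: real assume "r \<in> {0..}" "r' \<in> {0..}" "r \<le> r'"
    then have "0 \<in> P r s" "P r s \<subseteq> P r' s" using zero sub that by auto
    then show "\<psi> r s \<le> \<psi> r' s"
      unfolding \<psi>_def using bdd[OF that] by (intro cSup_subset_mono) auto
  qed
  have anti: "antimono_on {0..} (\<psi> r)" if "0 \<le> r" for r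
  proof (rule monotone_onI)
    fix s s' :: real assume "s \<in> {0..}" "s' \<in> {0..}" "s \<le> s'"
    then have "0 \<in> P r s'" "P r s' \<subseteq> P r s" "bdd_above (P r s)" using zero sub bdd that by auto
    then show "\<psi> r s' \<le> \<psi> r s"
      unfolding \<psi>_def by (intro cSup_subset_mono) auto
  qed
  have lim: "(\<psi> r \<longlongrightarrow> 0) at_top" if r: "0 \<le> r" for r
  proof (rule order_tendstoI)
    fix a :: real assume "a < 0"
    then have "a < \<psi> r s" if "0 \<le> s" for s
      using nonneg[OF r that] by simp
    then show "\<forall>\<^sub>F s in at_top. a < \<psi> r s"
      by (auto simp: eventually_at_top_linorder)
  next
    fix a :: real assume "0 < a"
    then have half: "0 < a / 2" by simp
    obtain T where T: "0 \<le> T"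
      "\<And>t0 t x0 u. 0 \<le> t0 \<Longrightarrow> t0 + T \<le> t \<Longrightarrow> u \<in> \<U> \<Longrightarrow> norm x0 \<le> r \<Longrightarrow> N u \<le> ennreal r \<Longrightarrow>
         norm (\<phi> t t0 x0 u) \<le> a / 2 + \<sigma> (enn2real (N u))"
      using uniform_attractivity[OF K \<sigma>(2) half r] by blast
    have "p \<le> a / 2" if p: "p \<in> P r T" for p
    proof -
      obtain t0 t x0 u where *: "p = norm (\<phi> t t0 x0 u) - \<sigma> (enn2real (N u))" "0 \<le> t0"
        "t0 + T \<le> t" "u \<in> \<U>" "norm x0 \<le> r" "N u \<le> ennreal r"
        using p unfolding P_def by blast
      show ?thesis using T(2)[OF *(2-6)] *(1) by simp
    qed
    moreover have "P r T \<noteq> {}" using zero[OF r T(1)] by auto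
    ultimately have "\<psi> r T \<le> a / 2"
      unfolding \<psi>_def by (intro cSup_least)
    then have "\<psi> r s < a" if "T \<le> s" for s
      using monotone_onD[OF anti[OF r], of T s] that T(1) \<open>0 < a\<close> by simp
    then show "\<forall>\<^sub>F s in at_top. \<psi> r s < a"
      by (auto simp: eventually_at_top_linorder)
  qed
  obtain \<gamma> where \<gamma>: "class_KL \<gamma>" "\<And>r s. 0 \<le> r \<Longrightarrow> 0 \<le> s \<Longrightarrow> \<psi> r s \<le> \<gamma> r s"
    using KL_majorant[OF mono anti lim nonneg le K] by blast
  have Kinf: "class_Kinf (\<lambda>r. 2 * \<sigma> r)"
  proof -
    have "bdd_above (\<sigma> ` {0..})" if "bdd_above ((\<lambda>r. 2 * \<sigma> r) ` {0..})"
    proof -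
      from that obtain B where B: "\<And>r. 0 \<le> r \<Longrightarrow> 2 * \<sigma> r \<le> B"
        by (auto simp: bdd_above_def)
      have "\<sigma> r \<le> B / 2" if "0 \<le> r" for r using B[OF that] by simp
      then show ?thesis by (intro bdd_aboveI[of _ "B / 2"]) auto
    qed
    moreover have "class_K (\<lambda>r. 2 * \<sigma> r)"
      using K by (auto simp: class_K_def strict_mono_on_def intro!: continuous_intros)
    ultimately show ?thesis using \<sigma>(1) by (auto simp: class_Kinf_def)
  qed
  show ?thesis
  proof (rule that[OF \<gamma>(1) Kinf])
    fix t0 t :: real and x0 :: 'x and u :: "real \<Rightarrow> 'v"
    assume *: "0 \<le> t0" "t0 \<le> t" "u \<in> \<U>" "N u < \<infinity>"
    have Nu: "ennreal (enn2real (N u)) = N u" using * by simp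
    show "norm (\<phi> t t0 x0 u) \<le> \<gamma> (norm x0) (t - t0) + 2 * \<sigma> (enn2real (N u))"
    proof (cases "enn2real (N u) \<le> norm x0")
      case True
      then have "N u \<le> ennreal (norm x0)" using Nu by (metis ennreal_leI)
      moreover have "t0 + (t - t0) \<le> t" by simp
      ultimately have "norm (\<phi> t t0 x0 u) - \<sigma> (enn2real (N u)) \<in> P (norm x0) (t - t0)"
        unfolding P_def using *(1,3) by blast
      then have "norm (\<phi> t t0 x0 u) - \<sigma> (enn2real (N u)) \<le> \<psi> (norm x0) (t - t0)"
        unfolding \<psi>_def using bdd * by (intro cSup_upper) auto
      also have "\<dots> \<le> \<gamma> (norm x0) (t - t0)" using \<gamma>(2) * by simp
      finally show ?thesis using \<sigma>_nonneg[of "enn2real (N u)"] by simp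
    next
      case False
      have "norm (\<phi> t t0 x0 u) \<le> \<sigma> (norm x0) + \<sigma> (enn2real (N u))"
        using \<sigma>(2) * by simp
      also have "\<sigma> (norm x0) \<le> \<sigma> (enn2real (N u))"
        using class_K_mono[OF K, of "norm x0"] False by simp
      finally have "norm (\<phi> t t0 x0 u) \<le> 2 * \<sigma> (enn2real (N u))" by simp
      moreover have "0 \<le> \<gamma> (norm x0) (t - t0)"
        using nonneg[of "norm x0" "t - t0"] \<gamma>(2)[of "norm x0" "t - t0"] * by simp
      ultimately show ?thesis by simp
    qed
  qed
qed

end

section \<open>The equivalence\<close>

theorem theorem3p1:
  fixes \<Sigma> :: "('x::real_normed_vector, 'v::real_vector) input_system"
    and N :: "(real \<Rightarrow> 'v) \<Rightarrow> ennreal"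
  assumes "system_with_inputs \<Sigma>"
    and "forward_complete \<Sigma>"
    and "admissible_functional \<Sigma> N"
    and "\<And>u t1 t2 t3. u \<in> inputs \<Sigma> \<Longrightarrow> 0 \<le> t1 \<Longrightarrow> t1 < t2 \<Longrightarrow> t2 < t3 \<Longrightarrow>
           N (restrict_input {t1<..t3} u) \<ge>
             N (restrict_input {t1<..t2} u) + N (restrict_input {t2<..t3} u)"
    and "\<And>r \<epsilon> T :: real. r > 0 \<Longrightarrow> \<epsilon> > 0 \<Longrightarrow> T > 0 \<Longrightarrow>
           \<exists>\<delta>>0. \<forall>t0\<ge>0. \<forall>x0. \<forall>u\<in>inputs \<Sigma>. N u \<le> ennreal \<delta> \<longrightarrow>
             (\<forall>t'\<in>{t0..t0 + T}.
                (\<forall>t\<in>{t0..t'}. norm (flow \<Sigma> t t0 x0 u) \<le> r \<and>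
                                norm (flow \<Sigma> t t0 x0 zero_input) \<le> r) \<longrightarrow>
                (\<forall>t\<in>{t0..t'}. norm (flow \<Sigma> t t0 x0 zero_input - flow \<Sigma> t t0 x0 u) \<le> \<epsilon>))"
  shows "zero_GUAS \<Sigma> \<and> UBEBS \<Sigma> N \<longleftrightarrow> iISS \<Sigma> N"
proof -
  interpret forward_complete_system \<Sigma> N
    using assms(1-3) by unfold_locales
  show ?thesis
  proof
    assume *: "zero_GUAS \<Sigma> \<and> UBEBS \<Sigma> N"
    then obtain \<beta> where \<beta>: "class_KL \<beta>"
      "\<And>t0 t x0. 0 \<le> t0 \<Longrightarrow> t0 \<le> t \<Longrightarrow> norm (\<phi> t t0 x0 zero_input) \<le> \<beta> (norm x0) (t - t0)"
      unfolding zero_GUAS_def by blast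
    interpret bounded_zero_GUAS_system \<Sigma> N \<beta>
      by (unfold_locales; (rule assms(4,5) \<beta> UBEBS_imp_bounded_reachable[OF conjunct2[OF *]]; assumption?))
    obtain \<gamma> \<rho> where \<gamma>: "class_KL \<gamma>" and \<rho>: "class_Kinf \<rho>" and
      bound: "\<And>t0 t x0 u. 0 \<le> t0 \<Longrightarrow> t0 \<le> t \<Longrightarrow> u \<in> \<U> \<Longrightarrow> N u < \<infinity> \<Longrightarrow>
         norm (\<phi> t t0 x0 u) \<le> \<gamma> (norm x0) (t - t0) + \<rho> (enn2real (N u))"
      using KL_Kinf_bound by blast
    have "ennreal (norm (\<phi> t t0 x0 u)) \<le> ennreal (\<gamma> (norm x0) (t - t0)) + gain_ext \<rho> (N u)"
      if t: "0 \<le> t0" "t0 \<le> t" "u \<in> \<U>" for t0 t x0 u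
    proof (cases "N u = \<infinity>")
      case False
      have "0 \<le> \<gamma> (norm x0) (t - t0)"
        using \<gamma> t by (auto simp: class_KL_def intro!: class_K_nonneg[of "\<lambda>r. \<gamma> r (t - t0)"])
      moreover have "0 \<le> \<rho> (enn2real (N u))"
        using \<rho> class_K_nonneg[of \<rho>] by (simp add: class_Kinf_def)
      moreover have "ennreal (norm (\<phi> t t0 x0 u)) \<le>
          ennreal (\<gamma> (norm x0) (t - t0) + \<rho> (enn2real (N u)))"
        by (intro ennreal_leI bound t) (use False in \<open>simp add: less_top\<close>)
      ultimately show ?thesis
        using False by (simp add: gain_ext_def)
    qed (simp add: gain_ext_def)
    then show "iISS \<Sigma> N"
      unfolding iISS_def using complete \<gamma> \<rho> by blast
  qed (use iISS_imp_zero_GUAS iISS_imp_UBEBS in blast)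
qed

end
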